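(* Let $n,m\ge 2$ and let $C$ be the rectangular checkerboard Clobber configuration with $n$ rows and $m$ columns. If $nm\equiv 0\pmod 3$, then $C$ is 2-reducible; otherwise $C$ is 1-reducible.
   Context: Clobber is played with black and white stones on a grid board whose squares are colored black and white in a checkerboard pattern. A move consists of picking up a stone and moving it onto a horizontally or vertically adjacent square occupied by a stone of the opposite color; that stone is removed and replaced by the moved stone. The rectangular checkerboard configuration with $n$ rows and $m$ columns has a stone on every square of an $n\times m$ rectangle of the board, each stone having the same color as the square it occupies (so colors alternate along rows and columns). In Solitaire Clobber, moves of white stones and moves of black stones alternate. A configuration is $k$-reducible if some alternating sequence of moves ends in a configuration with exactly $k$ stones, none of which can move (no stone is horizontally or vertically adjacent to a stone of the opposite color). *)

theory Defs
  imports Main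
begin

datatype colour = White | Black

fun opposite :: "colour \<Rightarrow> colour" where
  "opposite White = Black"
| "opposite Black = White"

type_synonym square = "int \<times> int"

fun square_colour :: "square \<Rightarrow> colour" where
  "square_colour (i, j) = (if even (i + j) then White else Black)"

fun adjacent :: "square \<Rightarrow> square \<Rightarrow> bool" where
  "adjacent (i, j) (i', j') \<longleftrightarrow> \<bar>i - i'\<bar> + \<bar>j - j'\<bar> = 1"

type_synonym config = "square \<Rightarrow> colour option"

text \<open>
  The rectangle with \<open>n\<close> rows and \<open>m\<close> columns whose corner square is \<open>(a, b)\<close>. The parity of
  \<open>a + b\<close> determines the colour of the corner, so varying the corner covers both colourings.
\<close>

definition checkerboard :: "int \<Rightarrow> int \<Rightarrow> nat \<Rightarrow> nat \<Rightarrow> config" where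
  "checkerboard a b n m =
     (\<lambda>p. if p \<in> {a..<a + int n} \<times> {b..<b + int m} then Some (square_colour p) else None)"

definition move :: "colour \<Rightarrow> config \<Rightarrow> config \<Rightarrow> bool" where
  "move c C C' \<longleftrightarrow>
     (\<exists>p q. adjacent p q \<and> C p = Some c \<and> C q = Some (opposite c) \<and>
            C' = C(p := None, q := Some c))"

inductive alternating_moves :: "colour \<Rightarrow> config \<Rightarrow> config \<Rightarrow> bool" where
  refl: "alternating_moves c C C"
| step: "move c C C' \<Longrightarrow> alternating_moves (opposite c) C' C'' \<Longrightarrow> alternating_moves c C C''"

definition immobile :: "config \<Rightarrow> bool" where
  "immobile C \<longleftrightarrow>
     (\<forall>p q c. adjacent p q \<longrightarrow> C p = Some c \<longrightarrow> C q \<noteq> Some (opposite c))"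

text \<open>
  Either colour may make the first move. Finiteness is required explicitly because the cardinality
  of an infinite set is \<open>0\<close>.
\<close>

definition reducible :: "nat \<Rightarrow> config \<Rightarrow> bool" where
  "reducible k C \<longleftrightarrow>
     (\<exists>c C'. alternating_moves c C C' \<and> finite (dom C') \<and> card (dom C') = k \<and> immobile C')"

end

theory Submission
  imports Defs
begin

text \<open>
  Once all stones but one have been cleared from a rectangle and that stone stands on a square of its
  own colour, it can walk on through an adjacent fully occupied strip of width \<open>3\<close>, clear the strip
  and stand again on a square of its own colour. In this way large rectangles are built up from a few
  small ones that are cleared by an explicit sequence of moves. When \<open>3\<close> divides \<open>n m\<close>, the small
  rectangle leaves one more stone behind that never moves again. When \<open>n m\<close> is \<open>2\<close> modulo \<open>3\<close>, the last
  stone has to end on a square of the opposite colour; this change is deferred to one final strip.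

  Boards with two rows are treated differently: three columns are cleared at each end. The sequences of
  moves at the two ends have complementary colours, and although neither alternates, they can be
  shuffled into an alternating one.
\<close>

section \<open>Plays and their combination\<close>

text \<open>The intermediate positions that matter have almost all stones on squares of their own
  colour, so a set of squares describes them. Disjoint unions of sets become \<open>++\<close> of
  configurations.\<close>

definition board :: "square set \<Rightarrow> config" where
  "board S = (\<lambda>p. if p \<in> S then Some (square_colour p) else None)"

lemma dom_board [simp]: "dom (board S) = S"
  by (auto simp: board_def split: if_splits)

lemma board_union: "board (S \<union> T) = board S ++ board T"
  by (auto simp: board_def map_add_def fun_eq_iff)

lemma checkerboard_eq_board:
  "checkerboard a b n m = board ({a..<a + int n} \<times> {b..<b + int m})"
  by (simp add: checkerboard_def board_def)

lemma opposite_opposite [simp]: "opposite (opposite c) = c"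
  by (cases c) auto

lemma opposite_neq [simp]: "opposite c \<noteq> c" "c \<noteq> opposite c"
  by (cases c; simp)+

lemma adjacent_commute: "adjacent p q \<longleftrightarrow> adjacent q p"
  by (cases p; cases q) (auto simp: abs_minus_commute)

lemma adjacent_irrefl [simp]: "\<not> adjacent p p"
  by (cases p) simp

text \<open>The colours of the moves are recorded but not forced to alternate, because two plays
  that do not alternate separately may do so once they are interleaved.\<close>

inductive play :: "config \<Rightarrow> colour list \<Rightarrow> config \<Rightarrow> bool" where
  Nil: "play C [] C"
| Cons: "move c C C' \<Longrightarrow> play C' cs C'' \<Longrightarrow> play C (c # cs) C''"

inductive_cases play_ConsE: "play C (c # cs) C'"
inductive_cases play_NilE: "play C [] C'"

text \<open>The last argument is the colour to move after the sequence. Tracking it makes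
  alternating sequences composable.\<close>

fun alternates :: "colour \<Rightarrow> colour list \<Rightarrow> colour \<Rightarrow> bool" where
  "alternates c [] d \<longleftrightarrow> c = d"
| "alternates c (x # xs) d \<longleftrightarrow> x = c \<and> alternates (opposite c) xs d"

definition run :: "colour \<Rightarrow> config \<Rightarrow> colour \<Rightarrow> config \<Rightarrow> bool" where
  "run c C d C' \<longleftrightarrow> (\<exists>cs. play C cs C' \<and> alternates c cs d)"

lemma play_append: "play C cs C' \<Longrightarrow> play C' ds C'' \<Longrightarrow> play C (cs @ ds) C''"
  by (induction rule: play.induct) (auto intro: play.intros)

lemma alternates_append: "alternates c cs d \<Longrightarrow> alternates d ds e \<Longrightarrow> alternates c (cs @ ds) e"
  by (induction c cs d rule: alternates.induct) auto

lemma run_trans: "run c C d C' \<Longrightarrow> run d C' e C'' \<Longrightarrow> run c C e C''"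
  unfolding run_def by (blast intro: play_append alternates_append)

lemma alternating_moves_play:
  "play C cs C' \<Longrightarrow> alternates c cs d \<Longrightarrow> alternating_moves d C' C'' \<Longrightarrow> alternating_moves c C C''"
  by (induction arbitrary: c rule: play.induct) (auto intro: alternating_moves.intros)

text \<open>It is unknown which colour starts in the reduction of \<open>C'\<close>. Therefore
  \<open>C'\<close> must be reachable with either colour starting, and the same colour must be on
  turn again at the end.\<close>

lemma reducible_if_runs:
  assumes "\<And>c. run c C c C'" and "reducible k C'"
  shows "reducible k C"
proof -
  from assms(2) obtain c C'' where C'': "alternating_moves c C' C''" "finite (dom C'')"
      "card (dom C'') = k" "immobile C''"
    unfolding reducible_def by blast
  from assms(1)[of c] C''(1) have "alternating_moves c C C''"
    unfolding run_def by (blast intro: alternating_moves_play)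
  with C'' show ?thesis unfolding reducible_def by blast
qed

lemma reducibleI:
  assumes "run c C d C'" "finite (dom C')" "card (dom C') = k" "immobile C'"
  shows "reducible k C"
proof -
  from assms(1) have "alternating_moves c C C'"
    unfolding run_def by (blast intro: alternating_moves_play alternating_moves.refl)
  with assms show ?thesis unfolding reducible_def by blast
qed

section \<open>Playing in disjoint regions\<close>

lemma move_dom: "move c C C' \<Longrightarrow> dom C' \<subseteq> dom C"
  by (auto simp: move_def split: if_splits)

lemma move_map_add:
  assumes "move c C C'" and "dom C \<inter> dom D = {}"
  shows "move c (C ++ D) (C' ++ D)"
proof -
  from assms(1) obtain p q where pq: "adjacent p q" "C p = Some c" "C q = Some (opposite c)"
      "C' = C(p := None, q := Some c)"
    unfolding move_def by blast
  from pq(2,3) assms(2) have D: "D p = None" "D q = None" by auto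
  with pq have "(C ++ D) p = Some c" "(C ++ D) q = Some (opposite c)"
    by (auto simp: map_add_def)
  moreover from D pq have "C' ++ D = (C ++ D)(p := None, q := Some c)"
    by (intro ext) (auto simp: map_add_def split: option.split)
  ultimately show ?thesis using pq(1) unfolding move_def by (intro exI conjI)
qed

lemma play_map_add:
  "play C cs C' \<Longrightarrow> dom C \<inter> dom D = {} \<Longrightarrow> play (C ++ D) cs (C' ++ D)"
proof (induction rule: play.induct)
  case (Cons c C C' cs C'')
  from move_dom[OF Cons.hyps(1)] Cons.prems have "dom C' \<inter> dom D = {}" by auto
  with Cons show ?case by (blast intro: play.Cons move_map_add)
qed (rule play.Nil)

lemma run_map_add: "run c C d C' \<Longrightarrow> dom C \<inter> dom D = {} \<Longrightarrow> run c (C ++ D) d (C' ++ D)"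
  unfolding run_def by (blast intro: play_map_add)

text \<open>A move changes only squares that are occupied before it, and domains never grow. Plays
  in disjoint regions therefore stay independent, and every interleaving of them is legal.\<close>

lemma play_shuffle:
  assumes "play C cs C'" "play D ds D'" "dom C \<inter> dom D = {}" "es \<in> shuffles cs ds"
  shows "play (C ++ D) es (C' ++ D')"
  using assms
proof (induction es arbitrary: C D cs ds)
  case Nil
  then show ?case by (auto elim: play_NilE intro: play.Nil)
next
  case (Cons e es)
  from Cons.prems(4) consider
      cs' where "cs = e # cs'" "es \<in> shuffles cs' ds"
    | ds' where "ds = e # ds'" "es \<in> shuffles cs ds'"
    by (cases cs; cases ds) (auto simp: Cons_in_shuffles_iff)
  then show ?case
  proof cases
    case 1
    with Cons.prems(1) obtain E where E: "move e C E" "play E cs' C'"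
      by (blast elim: play_ConsE)
    from move_dom[OF E(1)] Cons.prems(3) have "dom E \<inter> dom D = {}" by auto
    with Cons.IH[OF E(2) Cons.prems(2)] 1(2) have "play (E ++ D) es (C' ++ D')" by blast
    with move_map_add[OF E(1) Cons.prems(3)] show ?thesis by (rule play.Cons)
  next
    case 2
    with Cons.prems(2) obtain E where E: "move e D E" "play E ds' D'"
      by (blast elim: play_ConsE)
    have disj: "dom C \<inter> dom E = {}" using move_dom[OF E(1)] Cons.prems(3) by auto
    with Cons.IH[OF Cons.prems(1) E(2)] 2(2) have "play (C ++ E) es (C' ++ D')" by blast
    \<comment> \<open>The move now takes place in the right summand. Since the domains are disjoint,
      \<open>++\<close> commutes and the lemma for the left summand applies.\<close>
    moreover from move_map_add[OF E(1), of C] Cons.prems(3) disj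
    have "move e (C ++ D) (C ++ E)" by (metis Int_commute map_add_comm)
    ultimately show ?thesis by (blast intro: play.Cons)
  qed
qed

section \<open>Symmetries of the board\<close>

text \<open>The colour map \<open>g\<close> is carried along so that translations and reflections
  that exchange the square colours count as symmetries too.\<close>

definition isometry :: "(square \<Rightarrow> square) \<Rightarrow> (colour \<Rightarrow> colour) \<Rightarrow> bool" where
  "isometry f g \<longleftrightarrow> bij f \<and> (\<forall>p q. adjacent (f p) (f q) \<longleftrightarrow> adjacent p q) \<and>
     (\<forall>p. square_colour (f p) = g (square_colour p)) \<and> (\<forall>c. g (opposite c) = opposite (g c))"

definition transport :: "(square \<Rightarrow> square) \<Rightarrow> (colour \<Rightarrow> colour) \<Rightarrow> config \<Rightarrow> config" where
  "transport f g C = (\<lambda>p. map_option g (C (inv f p)))"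

lemma isometry_adjacent: "isometry f g \<Longrightarrow> adjacent (f p) (f q) \<longleftrightarrow> adjacent p q"
  unfolding isometry_def by blast

lemma isometry_colour: "isometry f g \<Longrightarrow> square_colour (f p) = g (square_colour p)"
  unfolding isometry_def by blast

lemma isometry_opposite: "isometry f g \<Longrightarrow> g (opposite c) = opposite (g c)"
  unfolding isometry_def by blast

lemma transport_apply: "isometry f g \<Longrightarrow> transport f g C (f p) = map_option g (C p)"
  by (simp add: transport_def isometry_def bij_is_inj)

lemma isometry_inv: "isometry f g \<Longrightarrow> f (inv f p) = p"
  by (simp add: isometry_def bij_is_surj surj_f_inv_f)

lemma isometry_inv2: "isometry f g \<Longrightarrow> inv f (f p) = p"
  by (simp add: isometry_def bij_is_inj)

lemma isometry_eq_iff: "isometry f g \<Longrightarrow> f p = f q \<longleftrightarrow> p = q"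
  by (simp add: isometry_def bij_is_inj inj_eq)

lemma transport_upd:
  assumes "isometry f g"
  shows "transport f g (C(p := x)) = (transport f g C)(f p := map_option g x)"
proof
  fix q
  obtain r where "q = f r" using isometry_inv[OF assms] by metis
  then show "transport f g (C(p := x)) q = ((transport f g C)(f p := map_option g x)) q"
    by (simp add: transport_apply[OF assms] isometry_eq_iff[OF assms])
qed

lemma transport_board:
  assumes "isometry f g"
  shows "transport f g (board S) = board (f ` S)"
proof
  fix q
  obtain r where q: "q = f r" using isometry_inv[OF assms] by metis
  from assms have "inj f" by (simp add: isometry_def bij_is_inj)
  then have "q \<in> f ` S \<longleftrightarrow> r \<in> S" by (simp add: q inj_image_mem_iff)
  with assms show "transport f g (board S) q = board (f ` S) q"
    unfolding q by (simp only: transport_apply board_def)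
      (simp add: isometry_colour[OF assms])
qed

lemma dom_transport: "isometry f g \<Longrightarrow> dom (transport f g C) = f ` dom C"
  by (force simp: transport_def isometry_inv isometry_inv2 image_iff)

text \<open>There are only two colours, so a map of colours that commutes with
  \<open>opposite\<close> is a permutation.\<close>

lemma isometry_colour_inj: "isometry f g \<Longrightarrow> g c = g d \<longleftrightarrow> c = d"
  unfolding isometry_def by (metis opposite_neq(1) opposite_opposite opposite.simps colour.exhaust)

lemma transport_move:
  assumes "isometry f g" and "move c C C'"
  shows "move (g c) (transport f g C) (transport f g C')"
proof -
  from assms(2) obtain p q where pq: "adjacent p q" "C p = Some c" "C q = Some (opposite c)"
      "C' = C(p := None, q := Some c)"
    unfolding move_def by blast
  have "adjacent (f p) (f q)" "g (opposite c) = opposite (g c)"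
    using pq(1) by (simp_all only: isometry_adjacent[OF assms(1)] isometry_opposite[OF assms(1)])
  moreover have "transport f g C' = (transport f g C)(f p := None, f q := Some (g c))"
    by (simp add: pq(4) transport_upd[OF assms(1)])
  ultimately show ?thesis
    using pq(2,3) transport_apply[OF assms(1)] unfolding move_def by (metis option.map(2))
qed

lemma transport_play:
  "play C cs C' \<Longrightarrow> isometry f g \<Longrightarrow> play (transport f g C) (map g cs) (transport f g C')"
  by (induction rule: play.induct) (auto intro: play.intros transport_move)

lemma alternates_map:
  "alternates c cs d \<Longrightarrow> isometry f g \<Longrightarrow> alternates (g c) (map g cs) (g d)"
  by (induction c cs d rule: alternates.induct) (simp_all add: isometry_opposite)

lemma transport_run:
  "run c C d C' \<Longrightarrow> isometry f g \<Longrightarrow> run (g c) (transport f g C) (g d) (transport f g C')"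
  unfolding run_def by (blast intro: transport_play alternates_map)

lemma transport_immobile:
  assumes "isometry f g" and "immobile C"
  shows "immobile (transport f g C)"
  unfolding immobile_def
proof (intro allI impI notI)
  fix p q c
  assume "adjacent p q" "transport f g C p = Some c" "transport f g C q = Some (opposite c)"
  moreover obtain p' q' where "p = f p'" "q = f q'" using isometry_inv[OF assms(1)] by metis
  ultimately obtain x y where *: "adjacent p' q'" "C p' = Some x" "C q' = Some y"
      "g x = c" "g y = opposite c"
    by (auto simp only: transport_apply[OF assms(1)] isometry_adjacent[OF assms(1)]
        option.map_sel map_option_eq_Some)
  then have "g y = g (opposite x)" by (simp only: isometry_opposite[OF assms(1)])
  then have "y = opposite x" by (simp only: isometry_colour_inj[OF assms(1)])
  with * assms(2) show False unfolding immobile_def by blast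
qed

lemma transport_alternating_moves:
  "alternating_moves c C C' \<Longrightarrow> isometry f g \<Longrightarrow>
    alternating_moves (g c) (transport f g C) (transport f g C')"
proof (induction rule: alternating_moves.induct)
  case (step c C C' C'')
  then show ?case
    using alternating_moves.step[OF transport_move[OF step.prems step.hyps(1)]]
    by (simp only: isometry_opposite[OF step.prems])
qed (rule alternating_moves.refl)

lemma reducible_isometry:
  assumes "reducible k (board S)" and "isometry f g"
  shows "reducible k (board (f ` S))"
proof -
  from assms(1) obtain c C where C: "alternating_moves c (board S) C" "finite (dom C)"
      "card (dom C) = k" "immobile C"
    unfolding reducible_def by blast
  have "card (dom (transport f g C)) = k" "finite (dom (transport f g C))"
    using C assms(2) by (auto simp: dom_transport isometry_eq_iff inj_on_def card_image)
  with transport_alternating_moves[OF C(1) assms(2)] transport_immobile[OF assms(2) C(4)]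
  show ?thesis unfolding reducible_def transport_board[OF assms(2)] by blast
qed

text \<open>The flags \<open>s\<close> and \<open>t\<close> select a reflection of the respective coordinate.\<close>

definition affine :: "bool \<Rightarrow> int \<Rightarrow> bool \<Rightarrow> int \<Rightarrow> square \<Rightarrow> square" where
  "affine s a t b = (\<lambda>(i, j). (if s then a - i else a + i, if t then b - j else b + j))"

lemma affine_apply [simp]:
  "affine s a t b (i, j) = (if s then a - i else a + i, if t then b - j else b + j)"
  by (simp add: affine_def)

text \<open>Modulo 2 a reflection \<open>a - i\<close> agrees with the translation
  \<open>a + i\<close>, so the effect on colours depends only on the parity of
  \<open>a + b\<close>.\<close>

lemma isometry_affine: "isometry (affine s a t b) (if even (a + b) then id else opposite)"
proof -
  have "bij (affine s a t b)"
    by (rule o_bij[of "affine s (if s then a else - a) t (if t then b else - b)"])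
      (auto simp: fun_eq_iff)
  then show ?thesis by (auto simp: isometry_def)
qed

lemma isometry_swap: "isometry prod.swap id"
  by (auto simp: isometry_def add.commute)

lemma affine_image:
  "affine s a t b ` ({i0..<i1} \<times> {j0..<j1}) =
     (if s then {a - i1 + 1..<a - i0 + 1} else {a + i0..<a + i1}) \<times>
     (if t then {b - j1 + 1..<b - j0 + 1} else {b + j0..<b + j1})"
proof -
  have "affine s a t b ` (I \<times> J) = (if s then (-) a ` I else (+) a ` I) \<times> (if t then (-) b ` J else (+) b ` J)"
    for I J by (auto simp: image_iff)
  moreover have "(-) x ` {y..<z} = {x - z + 1..<x - y + 1}" for x y z :: int
    by (auto simp: image_iff intro!: bexI[of _ "x - _"])
  moreover have "(+) x ` {y..<z} = {x + y..<x + z}" for x y z :: int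
    by (simp add: add.commute)
  ultimately show ?thesis by simp
qed

lemma swap_image: "prod.swap ` (I \<times> J) = J \<times> I"
  by auto

section \<open>Certificates\<close>

text \<open>Configurations become association lists so that a sequence of moves can be checked by
  evaluation. The stone that has just moved goes to the front, hence the final lists of the
  certificates below name the last mover first.\<close>

fun exec :: "(square \<times> colour) list \<Rightarrow> (square \<times> square) list \<Rightarrow>
    (colour list \<times> (square \<times> colour) list) option" where
  "exec xs [] = Some ([], xs)"
| "exec xs ((p, q) # ms) =
     (case map_of xs p of
        None \<Rightarrow> None
      | Some c \<Rightarrow>
          if adjacent p q \<and> map_of xs q = Some (opposite c)
          then map_option (\<lambda>(cs, ys). (c # cs, ys))
                 (exec ((q, c) # filter (\<lambda>z. fst z \<noteq> p \<and> fst z \<noteq> q) xs) ms)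
          else None)"

definition coloured :: "square list \<Rightarrow> (square \<times> colour) list" where
  "coloured xs = map (\<lambda>p. (p, square_colour p)) xs"

definition certifies :: "colour \<Rightarrow> square list \<Rightarrow> (square \<times> square) list \<Rightarrow> colour \<Rightarrow>
    (square \<times> colour) list \<Rightarrow> bool" where
  "certifies c xs ms d ys \<longleftrightarrow>
     (case exec (coloured xs) ms of None \<Rightarrow> False | Some (cs, zs) \<Rightarrow> alternates c cs d \<and> zs = ys)"

lemma map_of_coloured: "map_of (coloured xs) = board (set xs)"
  by (rule ext) (simp add: coloured_def board_def map_of_map_restrict restrict_map_def)

lemma map_of_filter_fst: "map_of (filter (\<lambda>z. P (fst z)) xs) r = (if P r then map_of xs r else None)"
  by (induction xs) auto

lemma play_exec: "exec xs ms = Some (cs, ys) \<Longrightarrow> play (map_of xs) cs (map_of ys)"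
proof (induction xs ms arbitrary: cs rule: exec.induct)
  case (1 xs)
  then show ?case by (auto intro: play.Nil)
next
  case (2 xs p q ms)
  let ?xs = "\<lambda>c. (q, c) # filter (\<lambda>z. fst z \<noteq> p \<and> fst z \<noteq> q) xs"
  from "2.prems" obtain c ds where c: "map_of xs p = Some c" "adjacent p q"
      "map_of xs q = Some (opposite c)" and ds: "exec (?xs c) ms = Some (ds, ys)" "cs = c # ds"
    by (auto split: option.splits if_splits)
  have "p \<noteq> q" using c(2) by auto
  then have "map_of (?xs c) = (map_of xs)(p := None, q := Some c)"
    using map_of_filter_fst[of "\<lambda>r. r \<noteq> p \<and> r \<noteq> q" xs]
    by (intro ext) (simp only: map_of.simps fst_conv snd_conv fun_upd_apply, simp)
  with c have "move c (map_of xs) (map_of (?xs c))"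
    unfolding move_def by (intro exI conjI)
  moreover have "play (map_of (?xs c)) ds (map_of ys)"
    using "2.IH" c ds(1) by blast
  ultimately show ?case unfolding ds(2) by (rule play.Cons)
qed

lemma run_certificate: "certifies c xs ms d ys \<Longrightarrow> run c (board (set xs)) d (map_of ys)"
  unfolding certifies_def run_def map_of_coloured[symmetric]
  by (auto split: option.splits intro: play_exec)

lemma immobile_pair: "\<not> adjacent p q \<or> c = d \<Longrightarrow> immobile [p \<mapsto> c, q \<mapsto> d]"
  using adjacent_commute[of p q]
  by (auto simp only: immobile_def fun_upd_apply option.inject adjacent_irrefl opposite_neq
      split: if_splits)

lemma immobile_single: "immobile [p \<mapsto> c]"
  using immobile_pair[of p p c c] by simp

lemma reducible_certificate1:
  assumes "certifies c xs ms d [(p, e)]" and "set xs = S"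
  shows "reducible 1 (board S)"
  by (rule reducibleI[OF run_certificate[OF assms(1)], unfolded assms(2)])
    (auto simp only: map_of.simps fst_conv snd_conv immobile_single, auto)

lemma reducible_certificate2:
  assumes "certifies c xs ms d [(p, e), (q, e')]" and "set xs = S" and "p \<noteq> q"
    and "\<not> adjacent p q \<or> e = e'"
  shows "reducible 2 (board S)"
proof -
  have "map_of [(p, e), (q, e')] = [q \<mapsto> e', p \<mapsto> e]" by simp
  moreover have "immobile [q \<mapsto> e', p \<mapsto> e]"
    using assms(4) adjacent_commute by (intro immobile_pair) metis
  ultimately show ?thesis
    using reducibleI[OF run_certificate[OF assms(1)], unfolded assms(2)] assms(3)
    by (auto simp: numeral_2_eq_2)
qed

section \<open>A single stone walking through a block\<close>

text \<open>
  The walking stone stands on a square of its own colour and has just moved, hence the other colour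
  is to move.
\<close>

definition eats :: "square \<Rightarrow> square set \<Rightarrow> square \<Rightarrow> bool" where
  "eats p R q \<longleftrightarrow> run (opposite (square_colour p)) (board (insert p R))
     (opposite (square_colour q)) (board {q})"

text \<open>Unlike in \<open>eats\<close>, the last stone may end on a square of either colour.
  Every move preserves modulo 3 the number of stones plus the number of stones on squares of the
  other colour. If the size of \<open>R\<close> is 1 modulo 3, the last stone therefore has to end
  on the other colour.\<close>

definition finishes :: "square \<Rightarrow> square set \<Rightarrow> bool" where
  "finishes p R \<longleftrightarrow> (\<exists>d q e. run (opposite (square_colour p)) (board (insert p R)) d [q \<mapsto> e])"

text \<open>\<open>X\<close> holds the stones that are left behind and never move again.\<close>

definition reaches :: "nat \<Rightarrow> square set \<Rightarrow> square \<Rightarrow> bool" where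
  "reaches k S q \<longleftrightarrow> q \<in> S \<and> (\<exists>c X. run c (board S) (opposite (square_colour q)) (X ++ board {q}) \<and>
     dom X \<subseteq> S - {q} \<and> finite (dom X) \<and> card (dom X) = k \<and> immobile X \<and>
     (\<forall>l \<in> dom X. \<not> adjacent l q))"

lemma board_single: "board {q} = [q \<mapsto> square_colour q]"
  by (rule ext) (simp add: board_def)

lemma eats_certificate:
  assumes "certifies c xs ms d [(q, e)]" and "c = opposite (square_colour p)"
    and "d = opposite (square_colour q)" and "e = square_colour q" and "set xs = insert p R"
  shows "eats p R q"
  using run_certificate[OF assms(1)] by (simp add: eats_def assms(2-) board_single)

lemma finishes_certificate:
  assumes "certifies c xs ms d [(q, e)]" and "c = opposite (square_colour p)" and "set xs = insert p R"
  shows "finishes p R"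
  using run_certificate[OF assms(1)] unfolding finishes_def assms(2,3) map_of.simps fst_conv snd_conv
  by blast

lemma reaches_certificate0:
  assumes "certifies c xs ms d [(q, e)]" and "d = opposite (square_colour q)" and "e = square_colour q"
    and "set xs = S" and "q \<in> S"
  shows "reaches 0 S q"
  using run_certificate[OF assms(1)] assms(5) unfolding reaches_def assms(2-4)
  by (auto simp: board_single immobile_def intro!: exI[of _ Map.empty])

text \<open>By the invariant modulo 3, if the size of \<open>S\<close> is divisible by 3 and the
  walking stone is on its own colour, the stone at \<open>l\<close> stands on a square of the other
  colour. It is therefore given by an explicit map and not by \<open>board\<close>.\<close>

lemma reaches_certificate1:
  assumes "certifies c xs ms d [(q, e), (l, e')]" and "d = opposite (square_colour q)"
    and "e = square_colour q" and "set xs = S" and "q \<in> S" and "l \<in> S - {q}" and "\<not> adjacent l q"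
  shows "reaches 1 S q"
proof -
  have "map_of [(q, e), (l, e')] = [l \<mapsto> e'] ++ board {q}"
    by (simp add: board_single assms(3))
  with run_certificate[OF assms(1)]
  have "run c (board S) (opposite (square_colour q)) ([l \<mapsto> e'] ++ board {q})"
    by (simp only: assms(2,4))
  with assms(5-7) show ?thesis
    unfolding reaches_def by (intro conjI exI[of _ c] exI[of _ "[l \<mapsto> e']"]) (simp_all add: immobile_single)
qed

section \<open>Chaining walks through adjacent blocks\<close>

lemma eats_union_run:
  assumes "eats p R q" and "p \<notin> T" and "R \<inter> T = {}"
  shows "run (opposite (square_colour p)) (board (insert p (R \<union> T)))
           (opposite (square_colour q)) (board (insert q T))"
  using run_map_add[OF assms(1)[unfolded eats_def], of "board T"] assms(2,3)
  by (simp add: board_union[symmetric])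

lemma eats_trans:
  assumes "eats p R q" "eats q T r" and "p \<notin> T" "R \<inter> T = {}"
  shows "eats p (R \<union> T) r"
  using run_trans[OF eats_union_run[OF assms(1,3,4)]] assms(2) by (simp add: eats_def)

lemma finishes_trans:
  assumes "eats p R q" "finishes q T" and "p \<notin> T" "R \<inter> T = {}"
  shows "finishes p (R \<union> T)"
  using run_trans[OF eats_union_run[OF assms(1,3,4)]] assms(2) unfolding finishes_def by blast

text \<open>The stones left behind are moved to the right of \<open>++\<close>, which is where
  \<open>run_map_add\<close> expects stones that stay untouched while the walk continues through
  \<open>R\<close>.\<close>

lemma reaches_run:
  assumes "reaches k S q" and "S \<inter> R = {}"
  obtains c X where "run c (board (S \<union> R)) (opposite (square_colour q)) (board (insert q R) ++ X)"
    "dom X \<subseteq> S - {q}" "finite (dom X)" "card (dom X) = k" "immobile X"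
    "\<forall>l \<in> dom X. \<not> adjacent l q"
proof -
  from assms(1) obtain c X where X: "run c (board S) (opposite (square_colour q)) (X ++ board {q})"
    "dom X \<subseteq> S - {q}" "finite (dom X)" "card (dom X) = k" "immobile X"
    "\<forall>l \<in> dom X. \<not> adjacent l q"
    unfolding reaches_def by blast
  have "run c (board (S \<union> R)) (opposite (square_colour q)) ((X ++ board {q}) ++ board R)"
    using run_map_add[OF X(1), of "board R"] assms(2) by (simp add: board_union)
  also have "(X ++ board {q}) ++ board R = X ++ board (insert q R)"
    using board_union[of "{q}" R] by (simp flip: map_add_assoc)
  also have "\<dots> = board (insert q R) ++ X"
    using X(2) assms(2) by (intro map_add_comm) auto
  finally show thesis using X(2-) that by blast
qed

text \<open>The stones left behind may be anywhere in \<open>S\<close>, so the new position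
  \<open>r\<close> must have no neighbour in \<open>S\<close> at all. The far column of a strip of
  width 3 satisfies this.\<close>

lemma reaches_trans:
  assumes "reaches k S q" "eats q R r" and "S \<inter> R = {}" "r \<in> R" "\<And>l. l \<in> S \<Longrightarrow> \<not> adjacent l r"
  shows "reaches k (S \<union> R) r"
proof -
  from reaches_run[OF assms(1,3)] obtain c X where
    X: "run c (board (S \<union> R)) (opposite (square_colour q)) (board (insert q R) ++ X)"
      "dom X \<subseteq> S - {q}" "finite (dom X)" "card (dom X) = k" "immobile X" .
  have "run (opposite (square_colour q)) (board (insert q R) ++ X)
          (opposite (square_colour r)) (board {r} ++ X)"
    using assms(2) X(2) assms(3) unfolding eats_def by (intro run_map_add) auto
  also have "board {r} ++ X = X ++ board {r}"
    using X(2) assms(3,4) by (intro map_add_comm) auto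
  finally have "run c (board (S \<union> R)) (opposite (square_colour r)) (X ++ board {r})"
    using X(1) run_trans by blast
  moreover have "dom X \<subseteq> S \<union> R - {r}" "\<forall>l \<in> dom X. \<not> adjacent l r"
    using X(2) assms(3-5) by auto
  ultimately show ?thesis unfolding reaches_def using X assms(4) by blast
qed

lemma reducible_if_reaches:
  assumes "reaches k S q"
  shows "reducible (Suc k) (board S)"
proof -
  from assms obtain c X where X: "run c (board S) (opposite (square_colour q)) (X ++ board {q})"
    "dom X \<subseteq> S - {q}" "finite (dom X)" "card (dom X) = k" "immobile X"
    "\<forall>l \<in> dom X. \<not> adjacent l q"
    unfolding reaches_def by blast
  have "immobile (X ++ board {q})"
    unfolding immobile_def
  proof (intro allI impI notI)
    fix a b e
    assume *: "adjacent a b" "(X ++ board {q}) a = Some e" "(X ++ board {q}) b = Some (opposite e)"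
    then have "a \<noteq> b" by auto
    have "a \<noteq> q"
      using * X(6) \<open>a \<noteq> b\<close> adjacent_commute by (auto simp: board_single split: if_splits)
    moreover have "b \<noteq> q"
      using * X(6) \<open>a \<noteq> b\<close> by (auto simp: board_single split: if_splits)
    ultimately show False using * X(5) unfolding immobile_def by (auto simp: board_single)
  qed
  moreover have "card (dom (X ++ board {q})) = Suc k" "finite (dom (X ++ board {q}))"
    using X(2-4) by (auto simp: card_insert_if)
  ultimately show ?thesis using X(1) reducibleI by blast
qed

lemma reducible_if_finishes:
  assumes "reaches 0 S q" "finishes q R" "S \<inter> R = {}"
  shows "reducible 1 (board (S \<union> R))"
proof -
  from reaches_run[OF assms(1,3)] obtain c X where
    X: "run c (board (S \<union> R)) (opposite (square_colour q)) (board (insert q R) ++ X)"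
      "finite (dom X)" "card (dom X) = 0" by metis
  \<comment> \<open>With \<open>k = 0\<close> nothing was left behind, so the stone that finishes
    \<open>R\<close> is the only one on the board.\<close>
  then have "X = Map.empty" by simp
  with X(1) assms(2) obtain d p e where "run c (board (S \<union> R)) d [p \<mapsto> e]"
    unfolding finishes_def by (auto dest: run_trans)
  then show ?thesis by (rule reducibleI) (auto simp: immobile_single)
qed

lemma eats_isometry: "eats p R q \<Longrightarrow> isometry f g \<Longrightarrow> eats (f p) (f ` R) (f q)"
  unfolding eats_def
  by (drule transport_run, assumption)
    (simp add: transport_board isometry_colour isometry_opposite del: square_colour.simps)

lemma finishes_isometry:
  assumes "finishes p R" "isometry f g"
  shows "finishes (f p) (f ` R)"
proof -
  from assms(1) obtain d q e where
    "run (opposite (square_colour p)) (board (insert p R)) d (Map.empty(q \<mapsto> e))"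
    unfolding finishes_def by blast
  from transport_run[OF this assms(2)] have
    "run (opposite (square_colour (f p))) (board (insert (f p) (f ` R))) (g d)
       ((transport f g Map.empty)(f q \<mapsto> g e))"
    by (simp add: transport_board[OF assms(2)] transport_upd[OF assms(2)]
        isometry_colour[OF assms(2)] isometry_opposite[OF assms(2)])
  moreover have "transport f g Map.empty = Map.empty"
    by (simp add: transport_def)
  ultimately show ?thesis unfolding finishes_def by (simp only:) blast
qed

lemma reaches_isometry:
  assumes "reaches k S q" "isometry f g"
  shows "reaches k (f ` S) (f q)"
proof -
  note inj = isometry_eq_iff[OF assms(2)]
  from assms(1) obtain c X where X: "run c (board S) (opposite (square_colour q)) (X ++ board {q})"
    "dom X \<subseteq> S - {q}" "finite (dom X)" "card (dom X) = k" "immobile X"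
    "\<forall>l \<in> dom X. \<not> adjacent l q" and "q \<in> S"
    unfolding reaches_def by blast
  let ?X = "transport f g X"
  have "transport f g (X ++ board {q}) = ?X ++ board {f q}"
    by (simp add: board_single transport_upd[OF assms(2)] isometry_colour[OF assms(2)])
  with transport_run[OF X(1) assms(2)]
  have "run (g c) (board (f ` S)) (opposite (square_colour (f q))) (?X ++ board {f q})"
    by (simp add: transport_board[OF assms(2)] isometry_colour[OF assms(2)] isometry_opposite[OF assms(2)])
  moreover have "dom ?X \<subseteq> f ` S - {f q}" "finite (dom ?X)" "\<forall>l \<in> dom ?X. \<not> adjacent l (f q)"
    using X by (auto simp add: dom_transport[OF assms(2)] inj isometry_adjacent[OF assms(2)] simp del: adjacent.simps)
  moreover have "card (dom ?X) = k"
    using X(4) by (simp add: dom_transport[OF assms(2)] card_image inj_on_def inj)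
  moreover have "immobile ?X" by (rule transport_immobile[OF assms(2) X(5)])
  ultimately show ?thesis unfolding reaches_def using \<open>q \<in> S\<close> by blast
qed

text \<open>
  The rows of the two extra stones are chosen such that the stones have opposite colours. The symmetry
  that exchanges the two ends therefore exchanges the colours.
\<close>

definition two_bumps :: "nat \<Rightarrow> square set" where
  "two_bumps t = insert (0, -1) (insert (int t mod 2, int t) ({0..<2} \<times> {0..<int t}))"

section \<open>Small blocks and boards cleared by explicit moves\<close>

lemma walk_5_3_left: "eats (0, -1) ({0..<5} \<times> {0..<3}) (4, 2)"
proof (rule eats_certificate)
  show "certifies White ((0, -1) # List.product [0..4] [0..2])
      [((2, 0), (1, 0)), ((0, -1), (0, 0)), ((4, 0), (4, 1)), ((0, 0), (1, 0)),
       ((0, 2), (0, 1)), ((1, 0), (1, 1)), ((0, 1), (1, 1)), ((1, 2), (2, 2)),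
       ((1, 1), (2, 1)), ((3, 0), (3, 1)), ((2, 1), (2, 2)), ((3, 1), (4, 1)),
       ((2, 2), (3, 2)), ((4, 1), (4, 2)), ((3, 2), (4, 2))]
      Black [((4, 2), White)]"
    by code_simp
qed auto

lemma walk_6_3_left: "eats (0, -1) ({0..<6} \<times> {0..<3}) (5, 2)"
proof (rule eats_certificate)
  show "certifies White ((0, -1) # List.product [0..5] [0..2])
      [((3, 1), (4, 1)), ((0, -1), (0, 0)), ((0, 2), (0, 1)), ((0, 0), (0, 1)),
       ((2, 0), (1, 0)), ((0, 1), (1, 1)), ((1, 0), (1, 1)), ((1, 2), (2, 2)),
       ((1, 1), (2, 1)), ((3, 0), (4, 0)), ((2, 1), (2, 2)), ((4, 0), (4, 1)),
       ((2, 2), (3, 2)), ((4, 1), (4, 2)), ((3, 2), (4, 2)), ((5, 0), (5, 1)),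
       ((4, 2), (5, 2)), ((5, 1), (5, 2))]
      White [((5, 2), Black)]"
    by code_simp
qed auto

text \<open>The stone enters from above in the last column and leaves in the last column of the
  bottom row. Copies of this block can thus be stacked, which lengthens the walks through five and
  six rows to any larger number of rows.\<close>

lemma walk_2_3_above2: "eats (-1, 2) ({0..<2} \<times> {0..<3}) (1, 2)"
proof (rule eats_certificate)
  show "certifies White ((-1, 2) # List.product [0..1] [0..2])
      [((0, 0), (1, 0)), ((0, 1), (1, 1)), ((1, 0), (1, 1)), ((-1, 2), (0, 2)),
       ((1, 1), (1, 2)), ((0, 2), (1, 2))]
      White [((1, 2), Black)]"
    by code_simp
qed auto

lemma walk_3_3_left: "eats (0, -1) ({0..<3} \<times> {0..<3}) (0, 2)"
proof (rule eats_certificate)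
  show "certifies White ((0, -1) # List.product [0..2] [0..2])
      [((2, 0), (1, 0)), ((0, -1), (0, 0)), ((1, 1), (1, 2)), ((2, 1), (2, 2)),
       ((1, 0), (0, 0)), ((2, 2), (1, 2)), ((0, 0), (0, 1)), ((1, 2), (0, 2)),
       ((0, 1), (0, 2))]
      Black [((0, 2), White)]"
    by code_simp
qed auto

text \<open>Clearing 12 stones takes 12 moves, so the same colour is on turn again and the stone
  ends on a square of the colour it started from. Three columns further on, the parity of its row
  must have changed. Row 0 leads to row 1 here, and the next walk leads back.\<close>

lemma walk_4_3_left: "eats (0, -1) ({0..<4} \<times> {0..<3}) (1, 2)"
proof (rule eats_certificate)
  show "certifies White ((0, -1) # List.product [0..3] [0..2])
      [((2, 0), (1, 0)), ((3, 0), (3, 1)), ((2, 2), (3, 2)), ((0, -1), (0, 0)),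
       ((3, 2), (3, 1)), ((0, 0), (1, 0)), ((3, 1), (2, 1)), ((0, 1), (1, 1)),
       ((2, 1), (1, 1)), ((1, 0), (1, 1)), ((0, 2), (1, 2)), ((1, 1), (1, 2))]
      White [((1, 2), Black)]"
    by code_simp
qed auto

lemma walk_4_3_left1: "eats (1, -1) ({0..<4} \<times> {0..<3}) (0, 2)"
proof (rule eats_certificate)
  show "certifies Black ((1, -1) # List.product [0..3] [0..2])
      [((3, 0), (2, 0)), ((0, 0), (0, 1)), ((3, 2), (2, 2)), ((1, -1), (1, 0)),
       ((2, 0), (1, 0)), ((3, 1), (2, 1)), ((1, 0), (1, 1)), ((2, 1), (2, 2)),
       ((1, 1), (0, 1)), ((2, 2), (1, 2)), ((0, 1), (0, 2)), ((1, 2), (0, 2))]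
      Black [((0, 2), White)]"
    by code_simp
qed auto

lemma walk_3_4_left: "eats (0, -1) ({0..<3} \<times> {0..<4}) (2, 1)"
proof (rule eats_certificate)
  show "certifies White ((0, -1) # List.product [0..2] [0..3])
      [((1, 3), (1, 2)), ((2, 3), (2, 2)), ((2, 0), (1, 0)), ((0, -1), (0, 0)),
       ((1, 0), (0, 0)), ((0, 3), (0, 2)), ((0, 0), (0, 1)), ((0, 2), (0, 1)),
       ((1, 2), (2, 2)), ((0, 1), (1, 1)), ((2, 2), (2, 1)), ((1, 1), (2, 1))]
      White [((2, 1), Black)]"
    by code_simp
qed auto

text \<open>The entry column 1 and the exit column 2 are mirror images in a block of four columns,
  so reflected copies can be stacked.\<close>

lemma walk_3_4_above1: "eats (-1, 1) ({0..<3} \<times> {0..<4}) (2, 2)"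
proof (rule eats_certificate)
  show "certifies Black ((-1, 1) # List.product [0..2] [0..3])
      [((1, 2), (1, 1)), ((-1, 1), (0, 1)), ((0, 3), (0, 2)), ((0, 0), (1, 0)),
       ((0, 2), (0, 1)), ((1, 0), (1, 1)), ((0, 1), (1, 1)), ((2, 0), (2, 1)),
       ((1, 1), (2, 1)), ((1, 3), (2, 3)), ((2, 1), (2, 2)), ((2, 3), (2, 2))]
      Black [((2, 2), White)]"
    by code_simp
qed auto

lemma finish_4_4_left: "finishes (0, -1) ({0..<4} \<times> {0..<4})"
proof (rule finishes_certificate)
  show "certifies White ((0, -1) # List.product [0..3] [0..3])
      [((2, 0), (3, 0)), ((2, 1), (3, 1)), ((0, 2), (0, 1)), ((0, -1), (0, 0)),
       ((3, 3), (2, 3)), ((0, 3), (1, 3)), ((3, 0), (3, 1)), ((1, 3), (2, 3)),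
       ((3, 1), (3, 2)), ((2, 3), (2, 2)), ((3, 2), (2, 2)), ((1, 0), (1, 1)),
       ((2, 2), (1, 2)), ((0, 0), (0, 1)), ((1, 2), (1, 1)), ((0, 1), (1, 1))]
      White [((1, 1), Black)]"
    by code_simp
qed auto

lemma finish_4_4_above1: "finishes (-1, 1) ({0..<4} \<times> {0..<4})"
proof (rule finishes_certificate)
  show "certifies Black ((-1, 1) # List.product [0..3] [0..3])
      [((2, 1), (3, 1)), ((0, 0), (0, 1)), ((1, 0), (1, 1)), ((2, 0), (3, 0)),
       ((0, 3), (0, 2)), ((1, 3), (1, 2)), ((0, 2), (0, 1)), ((3, 0), (3, 1)),
       ((2, 3), (3, 3)), ((3, 1), (3, 2)), ((3, 3), (3, 2)), ((-1, 1), (0, 1)),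
       ((3, 2), (2, 2)), ((0, 1), (1, 1)), ((2, 2), (1, 2)), ((1, 1), (1, 2))]
      Black [((1, 2), White)]"
    by code_simp
qed auto

lemma finish_5_2_left: "finishes (0, -1) ({0..<5} \<times> {0..<2})"
proof (rule finishes_certificate)
  show "certifies White ((0, -1) # List.product [0..4] [0..1])
      [((3, 1), (3, 0)), ((2, 1), (2, 0)), ((1, 1), (0, 1)), ((0, -1), (0, 0)),
       ((0, 1), (0, 0)), ((4, 1), (4, 0)), ((0, 0), (1, 0)), ((4, 0), (3, 0)),
       ((1, 0), (2, 0)), ((3, 0), (2, 0))]
      White [((2, 0), Black)]"
    by code_simp
qed auto

lemma reaches_3_3_0: "reaches 1 ({0..<3} \<times> {0..<3}) (0, 2)"
proof (rule reaches_certificate1)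
  show "certifies White (List.product [0..2] [0..2])
      [((0, 0), (1, 0)), ((2, 1), (2, 0)), ((2, 2), (1, 2)), ((2, 0), (1, 0)),
       ((1, 1), (1, 0)), ((0, 1), (0, 2)), ((1, 2), (0, 2))]
      Black [((0, 2), White), ((1, 0), White)]"
    by code_simp
qed auto

lemma reaches_3_5_0: "reaches 1 ({0..<3} \<times> {0..<5}) (0, 4)"
proof (rule reaches_certificate1)
  show "certifies White (List.product [0..2] [0..4])
      [((1, 1), (0, 1)), ((2, 3), (2, 4)), ((1, 3), (1, 4)), ((1, 0), (0, 0)),
       ((2, 2), (1, 2)), ((0, 0), (0, 1)), ((2, 0), (2, 1)), ((0, 1), (0, 2)),
       ((1, 2), (0, 2)), ((2, 4), (1, 4)), ((0, 2), (0, 3)), ((1, 4), (0, 4)),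
       ((0, 3), (0, 4))]
      Black [((0, 4), White), ((2, 1), White)]"
    by code_simp
qed auto

lemma reaches_4_3_0: "reaches 1 ({0..<4} \<times> {0..<3}) (0, 2)"
proof (rule reaches_certificate1)
  show "certifies Black (List.product [0..3] [0..2])
      [((3, 0), (2, 0)), ((0, 0), (0, 1)), ((3, 2), (3, 1)), ((1, 1), (1, 0)),
       ((1, 2), (0, 2)), ((2, 2), (2, 1)), ((3, 1), (2, 1)), ((1, 0), (2, 0)),
       ((2, 1), (2, 0)), ((0, 1), (0, 2))]
      Black [((0, 2), White), ((2, 0), Black)]"
    by code_simp
qed auto

lemma reaches_4_3_1: "reaches 1 ({0..<4} \<times> {0..<3}) (1, 2)"
proof (rule reaches_certificate1)
  show "certifies White (List.product [0..3] [0..2])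
      [((0, 2), (1, 2)), ((3, 0), (2, 0)), ((3, 1), (2, 1)), ((2, 0), (2, 1)),
       ((0, 0), (0, 1)), ((1, 0), (1, 1)), ((0, 1), (1, 1)), ((3, 2), (2, 2)),
       ((1, 1), (2, 1)), ((2, 2), (1, 2))]
      White [((1, 2), Black), ((2, 1), White)]"
    by code_simp
qed auto

text \<open>The rectangle is empty here, and the two extra stones are adjacent to each
  other.\<close>

lemma reducible_two_bumps_0: "reducible 1 (board (two_bumps 0))"
proof (rule reducible_certificate1)
  show "certifies White ((0, -1) # (0, 0) # List.product [0..1] [0..-1])
      [((0, 0), (0, -1))]
      Black [((0, -1), White)]"
    by code_simp
qed (auto simp: two_bumps_def)

lemma reducible_two_bumps_1: "reducible 1 (board (two_bumps 1))"
proof (rule reducible_certificate1)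
  show "certifies White ((0, -1) # (1, 1) # List.product [0..1] [0..0])
      [((1, 1), (1, 0)), ((0, -1), (0, 0)), ((1, 0), (0, 0))]
      Black [((0, 0), White)]"
    by code_simp
qed (auto simp: two_bumps_def)

lemma reducible_two_bumps_2: "reducible 2 (board (two_bumps 2))"
proof (rule reducible_certificate2)
  show "certifies White ((0, -1) # (0, 2) # List.product [0..1] [0..1])
      [((1, 1), (0, 1)), ((1, 0), (0, 0)), ((0, 1), (0, 0)), ((0, -1), (0, 0))]
      White [((0, 0), Black), ((0, 2), White)]"
    by code_simp
qed (auto simp: two_bumps_def)

lemma reducible_two_bumps_3: "reducible 1 (board (two_bumps 3))"
proof (rule reducible_certificate1)
  show "certifies White ((0, -1) # (1, 3) # List.product [0..1] [0..2])
      [((0, 2), (0, 1)), ((1, 0), (1, 1)), ((1, 3), (1, 2)), ((0, -1), (0, 0)),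
       ((1, 2), (1, 1)), ((0, 0), (0, 1)), ((1, 1), (0, 1))]
      Black [((0, 1), White)]"
    by code_simp
qed (auto simp: two_bumps_def)

lemma reducible_two_bumps_4: "reducible 1 (board (two_bumps 4))"
proof (rule reducible_certificate1)
  show "certifies White ((0, -1) # (0, 4) # List.product [0..1] [0..3])
      [((1, 3), (1, 2)), ((1, 0), (1, 1)), ((1, 2), (1, 1)), ((0, -1), (0, 0)),
       ((1, 1), (0, 1)), ((0, 0), (0, 1)), ((0, 4), (0, 3)), ((0, 1), (0, 2)),
       ((0, 3), (0, 2))]
      Black [((0, 2), White)]"
    by code_simp
qed (auto simp: two_bumps_def)

lemma reducible_two_bumps_5: "reducible 2 (board (two_bumps 5))"
proof (rule reducible_certificate2)
  show "certifies White ((0, -1) # (1, 5) # List.product [0..1] [0..4])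
      [((1, 1), (0, 1)), ((1, 0), (0, 0)), ((1, 3), (0, 3)), ((1, 2), (0, 2)),
       ((1, 5), (1, 4)), ((0, 2), (0, 3)), ((0, 1), (0, 0)), ((0, 3), (0, 4)),
       ((1, 4), (0, 4)), ((0, -1), (0, 0))]
      White [((0, 0), Black), ((0, 4), White)]"
    by code_simp
qed (auto simp: two_bumps_def)

lemma reducible_2_2: "reducible 1 (board ({0..<2} \<times> {0..<2}))"
proof (rule reducible_certificate1)
  show "certifies White (List.product [0..1] [0..1])
      [((1, 1), (1, 0)), ((0, 1), (0, 0)), ((1, 0), (0, 0))]
      Black [((0, 0), White)]"
    by code_simp
qed auto

lemma reducible_2_3: "reducible 2 (board ({0..<2} \<times> {0..<3}))"
proof (rule reducible_certificate2)
  show "certifies White (List.product [0..1] [0..2])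
      [((1, 1), (1, 2)), ((0, 1), (0, 2)), ((0, 0), (1, 0)), ((0, 2), (1, 2))]
      White [((1, 2), Black), ((1, 0), White)]"
    by code_simp
qed auto

lemma reaches_4_4_0: "reaches 0 ({0..<4} \<times> {0..<4}) (0, 3)"
proof (rule reaches_certificate0)
  show "certifies Black (List.product [0..3] [0..3])
      [((0, 1), (0, 2)), ((3, 1), (2, 1)), ((3, 0), (2, 0)), ((2, 2), (2, 3)),
       ((2, 0), (2, 1)), ((0, 0), (1, 0)), ((2, 1), (1, 1)), ((1, 0), (1, 1)),
       ((3, 2), (3, 3)), ((1, 1), (1, 2)), ((3, 3), (2, 3)), ((1, 2), (0, 2)),
       ((2, 3), (1, 3)), ((0, 2), (0, 3)), ((1, 3), (0, 3))]
      White [((0, 3), Black)]"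
    by code_simp
qed auto

lemma reaches_4_4_1: "reaches 0 ({0..<4} \<times> {0..<4}) (1, 3)"
proof (rule reaches_certificate0)
  show "certifies White (List.product [0..3] [0..3])
      [((2, 0), (1, 0)), ((2, 3), (2, 2)), ((3, 3), (3, 2)), ((0, 1), (0, 0)),
       ((0, 2), (1, 2)), ((3, 0), (3, 1)), ((3, 2), (3, 1)), ((0, 0), (1, 0)),
       ((3, 1), (2, 1)), ((1, 0), (1, 1)), ((2, 1), (2, 2)), ((1, 1), (1, 2)),
       ((2, 2), (1, 2)), ((0, 3), (1, 3)), ((1, 2), (1, 3))]
      Black [((1, 3), White)]"
    by code_simp
qed auto

lemma reaches_5_5_0: "reaches 0 ({0..<5} \<times> {0..<5}) (0, 4)"
proof (rule reaches_certificate0)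
  show "certifies Black (List.product [0..4] [0..4])
      [((3, 2), (4, 2)), ((1, 3), (0, 3)), ((4, 3), (3, 3)), ((1, 1), (2, 1)),
       ((3, 0), (2, 0)), ((4, 4), (3, 4)), ((1, 2), (2, 2)), ((4, 0), (4, 1)),
       ((4, 2), (4, 1)), ((0, 0), (1, 0)), ((4, 1), (3, 1)), ((1, 0), (2, 0)),
       ((3, 1), (2, 1)), ((2, 0), (2, 1)), ((3, 3), (3, 4)), ((2, 1), (2, 2)),
       ((0, 1), (0, 2)), ((2, 2), (2, 3)), ((3, 4), (2, 4)), ((2, 3), (2, 4)),
       ((0, 2), (0, 3)), ((2, 4), (1, 4)), ((0, 3), (0, 4)), ((1, 4), (0, 4))]
      Black [((0, 4), White)]"
    by code_simp
qed auto

text \<open>This is the one board with residues 1 and 2 and sides at least 4 that is too small to be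
  split into a smaller board and a finishing strip below.\<close>

lemma reducible_4_5: "reducible 1 (board ({0..<4} \<times> {0..<5}))"
proof (rule reducible_certificate1)
  show "certifies White (List.product [0..3] [0..4])
      [((3, 3), (3, 4)), ((0, 3), (1, 3)), ((2, 0), (2, 1)), ((1, 0), (0, 0)),
       ((0, 4), (1, 4)), ((1, 3), (1, 4)), ((0, 2), (0, 1)), ((1, 4), (2, 4)),
       ((3, 4), (2, 4)), ((3, 2), (2, 2)), ((2, 4), (2, 3)), ((3, 0), (3, 1)),
       ((2, 3), (2, 2)), ((3, 1), (2, 1)), ((2, 2), (1, 2)), ((2, 1), (1, 1)),
       ((1, 2), (1, 1)), ((0, 0), (0, 1)), ((1, 1), (0, 1))]
      Black [((0, 1), White)]"
    by code_simp
qed auto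

section \<open>Boards with two rows\<close>

lemma play_certificate:
  assumes "exec (coloured xs) ms = Some (cs, [(q, e)])" and "e = square_colour q" and "set xs = S"
  shows "play (board S) cs (board {q})"
  using play_exec[OF assms(1)] by (simp add: map_of_coloured assms(2,3) board_single)

text \<open>The far end is played as the mirror image of the near one. Since \<open>f\<close>
  exchanges the colours, it contributes the complementary colour sequence, and the middle
  \<open>M\<close> is not touched.\<close>

lemma run_two_ends:
  assumes "play (board L) cs (board {q})" and f: "isometry f opposite"
    and "L \<inter> f ` L = {}" and "(L \<union> f ` L) \<inter> M = {}"
    and "\<And>c. \<exists>es \<in> shuffles cs (map opposite cs). alternates c es c"
  shows "run c (board (L \<union> f ` L \<union> M)) c (board (insert q (insert (f q) M)))"
proof -
  from assms(5) obtain es where es: "es \<in> shuffles cs (map opposite cs)" "alternates c es c"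
    by blast
  have "play (board (f ` L)) (map opposite cs) (board {f q})"
    using transport_play[OF assms(1) f] by (simp add: transport_board[OF f])
  from play_shuffle[OF assms(1) this _ es(1)] assms(3)
  have "play (board (L \<union> f ` L)) es (board {q, f q})"
    by (simp flip: board_union add: insert_commute)
  from play_map_add[OF this, of "board M"] assms(4)
  have "play (board (L \<union> f ` L \<union> M)) es (board (insert q (insert (f q) M)))"
    by (simp flip: board_union)
  with es(2) show ?thesis unfolding run_def by blast
qed

text \<open>The net effect is to move the extra stone three columns to the right, again onto a
  square of its own colour.\<close>

lemma play_left_end:
  "play (board (insert (0, -1) ({0..<2} \<times> {0..<3}))) [White, Black, White, Black, White, White]
     (board {(0, 2)})"
proof (rule play_certificate)
  show "exec (coloured ((0, -1) # List.product [0..1] [0..2]))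
      [((1, 1), (1, 0)), ((0, -1), (0, 0)), ((1, 0), (0, 0)), ((1, 2), (0, 2)),
       ((0, 0), (0, 1)), ((0, 1), (0, 2))]
      = Some ([White, Black, White, Black, White, White], [((0, 2), White)])"
    by code_simp
qed auto

lemma play_corner:
  "play (board ({0..<2} \<times> {0..<2})) [Black, White, Black] (board {(0, 1)})"
proof (rule play_certificate)
  show "exec (coloured (List.product [0..1] [0..1]))
      [((1, 0), (1, 1)), ((0, 0), (0, 1)), ((1, 1), (0, 1))]
      = Some ([Black, White, Black], [((0, 1), Black)])"
    by code_simp
qed auto

text \<open>One end plays until it would need the same colour twice in a row. The other end then
  plays its first five moves, and one move at each end remains. Which end begins depends on
  \<open>c\<close>.\<close>

lemma shuffle_left_end:
  "\<exists>es \<in> shuffles [White, Black, White, Black, White, White]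
             (map opposite [White, Black, White, Black, White, White]). alternates c es c"
proof -
  have "[White, Black, White, Black, White, Black, White, Black, White, Black, White, Black]
      \<in> shuffles [White, Black, White, Black, White, White] [Black, White, Black, White, Black, Black]"
    by ((rule Cons_in_shuffles_leftI)+, (rule Cons_in_shuffles_rightI)+,
        (rule Cons_in_shuffles_leftI)+, (rule Cons_in_shuffles_rightI)+, simp)
  moreover
  have "[Black, White, Black, White, Black, White, Black, White, Black, White, Black, White]
      \<in> shuffles [White, Black, White, Black, White, White] [Black, White, Black, White, Black, Black]"
    by ((rule Cons_in_shuffles_rightI)+, (rule Cons_in_shuffles_leftI)+,
        (rule Cons_in_shuffles_rightI)+, (rule Cons_in_shuffles_leftI)+, simp)
  moreover have "alternates White [White, Black, White, Black, White, Black, White, Black, White, Black, White, Black] White"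
    and "alternates Black [Black, White, Black, White, Black, White, Black, White, Black, White, Black, White] Black"
    by simp_all
  ultimately show ?thesis unfolding list.map opposite.simps by (cases c) blast+
qed

text \<open>Both sequences alternate and fit together end to end, in either order. The order is
  chosen by \<open>c\<close>.\<close>

lemma shuffle_corner:
  "\<exists>es \<in> shuffles [Black, White, Black] (map opposite [Black, White, Black]). alternates c es c"
proof -
  have "[White, Black, White, Black, White, Black] \<in> shuffles [Black, White, Black] [White, Black, White]"
    by ((rule Cons_in_shuffles_rightI)+, (rule Cons_in_shuffles_leftI)+, simp)
  moreover
  have "[Black, White, Black, White, Black, White] \<in> shuffles [Black, White, Black] [White, Black, White]"
    by ((rule Cons_in_shuffles_leftI)+, (rule Cons_in_shuffles_rightI)+, simp)
  moreover have "alternates White [White, Black, White, Black, White, Black] White"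
    and "alternates Black [Black, White, Black, White, Black, White] Black"
    by simp_all
  ultimately show ?thesis unfolding list.map opposite.simps by (cases c) blast+
qed

lemma isometry_affine_odd: "odd (a + b) \<Longrightarrow> isometry (affine s a t b) opposite"
  using isometry_affine[of s a t b] by simp

lemma translate_two_bumps:
  "affine False 0 False d ` two_bumps t =
     insert (0, d - 1) (insert (int t mod 2, d + int t) ({0..<2} \<times> {d..<d + int t}))"
  by (simp add: two_bumps_def affine_image)

lemma reducible_two_bumps_step:
  assumes "reducible k (board (two_bumps t))"
  shows "reducible k (board (two_bumps (t + 6)))"
proof (rule reducible_if_runs)
  let ?L = "insert (0, -1) ({0..<2} \<times> {0..<3}) :: square set"
  let ?M = "{0..<2} \<times> {3..<3 + int t}"
  \<comment> \<open>The columns are reversed, and for odd \<open>t\<close> the two rows are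
    exchanged as well. This sends the left extra stone to the right one and always makes the sum of
    the two offsets odd, so that the colours are exchanged.\<close>
  let ?f = "affine (odd t) (int t mod 2) True (int t + 5)"
  have f: "isometry ?f opposite"
    by (rule isometry_affine_odd) (simp add: mod2_eq_if)
  have f_L: "?f ` ?L = insert (int t mod 2, int t + 6) ({0..<2} \<times> {int t + 3..<int t + 6})"
    by (simp add: affine_image mod2_eq_if add.commute)
  have "?L \<inter> ?f ` ?L = {}" "(?L \<union> ?f ` ?L) \<inter> ?M = {}"
    unfolding f_L by auto
  note run_two_ends[OF play_left_end f this shuffle_left_end]
  moreover have "int (t + 6) mod 2 = int t mod 2" by presburger
  then have "?L \<union> ?f ` ?L \<union> ?M = two_bumps (t + 6)"
    unfolding f_L two_bumps_def by auto
  \<comment> \<open>Three columns are gone at each end, leaving the shape for \<open>t\<close>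
    shifted by three columns. The shift exchanges the colours, which \<open>reducible\<close> does
    not notice.\<close>
  moreover have "insert (0, 2) (insert (?f (0, 2)) ?M) = affine False 0 False 3 ` two_bumps t"
    by (simp add: translate_two_bumps mod2_eq_if add.commute)
  ultimately show "run c (board (two_bumps (t + 6))) c
      (board (affine False 0 False 3 ` two_bumps t))" for c
    by simp
  show "reducible k (board (affine False 0 False 3 ` two_bumps t))"
    by (rule reducible_isometry[OF assms isometry_affine])
qed

text \<open>Clearing a 2 by 2 corner at each end except for one stone creates the two extra stones
  beside the \<open>t\<close> remaining columns.\<close>

lemma reducible_two_rows_if_two_bumps:
  assumes "reducible k (board (two_bumps t))"
  shows "reducible k (board ({0..<2} \<times> {0..<int t + 4}))"
proof (rule reducible_if_runs)
  let ?L = "{0..<2} \<times> {0..<2} :: square set"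
  let ?M = "{0..<2} \<times> {2..<2 + int t}"
  let ?f = "affine (odd t) (int t mod 2) True (int t + 3)"
  have f: "isometry ?f opposite"
    by (rule isometry_affine_odd) (simp add: mod2_eq_if)
  have f_L: "?f ` ?L = {0..<2} \<times> {int t + 2..<int t + 4}"
    by (simp add: affine_image mod2_eq_if add.commute)
  have "?L \<inter> ?f ` ?L = {}" "(?L \<union> ?f ` ?L) \<inter> ?M = {}"
    unfolding f_L by auto
  note run_two_ends[OF play_corner f this shuffle_corner]
  moreover have "?L \<union> ?f ` ?L \<union> ?M = {0..<2} \<times> {0..<int t + 4}"
    unfolding f_L by auto
  moreover have "insert (0, 1) (insert (?f (0, 1)) ?M) = affine False 0 False 2 ` two_bumps t"
    by (simp add: translate_two_bumps mod2_eq_if add.commute)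
  ultimately show "run c (board ({0..<2} \<times> {0..<int t + 4})) c
      (board (affine False 0 False 2 ` two_bumps t))" for c
    by simp
  show "reducible k (board (affine False 0 False 2 ` two_bumps t))"
    by (rule reducible_isometry[OF assms isometry_affine])
qed

text \<open>The position has \<open>2 * t + 2\<close> stones, a multiple of 3 exactly when
  \<open>t mod 3 = 2\<close>.\<close>

lemma reducible_two_bumps: "reducible (if t mod 3 = 2 then 2 else 1) (board (two_bumps t))"
proof (induction t rule: less_induct)
  case (less t)
  consider "t = 0" | "t = 1" | "t = 2" | "t = 3" | "t = 4" | "t = 5" | "t \<ge> 6" by linarith
  then show ?case
  proof cases
    case 7
    then obtain s where s: "t = s + 6" by (metis add.commute le_Suc_ex)
    have "(s + 6) mod 3 = s mod 3" by presburger
    with reducible_two_bumps_step[OF less.IH[of s]] show ?thesis by (simp add: s)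
  qed (use reducible_two_bumps_0 reducible_two_bumps_1 reducible_two_bumps_2 reducible_two_bumps_3 reducible_two_bumps_4
      reducible_two_bumps_5 in simp_all)
qed

lemma reducible_two_rows:
  assumes "m \<ge> 2"
  shows "reducible (if m mod 3 = 0 then 2 else 1) (board ({0..<2} \<times> {0..<int m}))"
proof -
  consider "m = 2" | "m = 3" | "m \<ge> 4" using assms by linarith
  then show ?thesis
  proof cases
    case 3
    then obtain t where t: "m = t + 4" by (metis add.commute le_Suc_ex)
    have "t mod 3 = 2 \<longleftrightarrow> (t + 4) mod 3 = 0" by presburger
    with reducible_two_rows_if_two_bumps[OF reducible_two_bumps, of t] show ?thesis
      by (simp add: t)
  qed (use reducible_2_2 reducible_2_3 in simp_all)
qed

section \<open>Boards with at least three rows and columns\<close>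

abbreviation rect :: "nat \<Rightarrow> nat \<Rightarrow> square set" where
  "rect n m \<equiv> {0..<int n} \<times> {0..<int m}"

definition leftover :: "nat \<Rightarrow> nat \<Rightarrow> nat" where
  "leftover n m = (if 3 dvd n * m then 1 else 0)"

definition corner :: "nat \<Rightarrow> nat \<Rightarrow> bool" where
  "corner n m \<longleftrightarrow> reaches (leftover n m) (rect n m) (0, int m - 1)"

lemma leftover_commute: "leftover n m = leftover m n"
  by (simp add: leftover_def mult.commute)

lemma leftover_add3: "leftover n (m + 3) = leftover n m"
  by (simp add: leftover_def distrib_left)

lemma eats_affine: "eats p R q \<Longrightarrow> eats (affine s a t b p) (affine s a t b ` R) (affine s a t b q)"
  by (rule eats_isometry[OF _ isometry_affine])

lemma finishes_affine: "finishes p R \<Longrightarrow> finishes (affine s a t b p) (affine s a t b ` R)"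
  by (rule finishes_isometry[OF _ isometry_affine])

lemma reaches_affine: "reaches k S q \<Longrightarrow> reaches k (affine s a t b ` S) (affine s a t b q)"
  by (rule reaches_isometry[OF _ isometry_affine])

text \<open>Transposing takes the top right corner to the bottom left one, and a half turn brings it
  back.\<close>

lemma corner_transpose:
  assumes "corner n m"
  shows "corner m n"
proof -
  have "reaches (leftover m n) (rect m n) (int m - 1, 0)"
    using reaches_isometry[OF assms[unfolded corner_def] isometry_swap]
    by (simp add: swap_image leftover_commute)
  from reaches_affine[OF this, of True "int m - 1" True "int n - 1"]
  show ?thesis by (simp add: corner_def affine_image)
qed

lemma walk_strip: "n \<ge> 5 \<Longrightarrow> eats (0, -1) (rect n 3) (int n - 1, 2)"
proof (induction n rule: less_induct)
  case (less n)
  consider "n = 5" | "n = 6" | "n \<ge> 7" using less.prems by linarith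
  then show ?case
  proof cases
    case 3
    define k where "k = n - 2"
    have k: "k < n" "k \<ge> 5" "n = k + 2" using 3 by (auto simp: k_def)
    have "eats (int k - 1, 2) ({int k..<int k + 2} \<times> {0..<3}) (int k + 1, 2)"
      using eats_affine[OF walk_2_3_above2, of False "int k" False 0]
      by (simp add: affine_image)
    with less.IH[OF k(1,2)] have "eats (0, -1) (rect k 3 \<union> {int k..<int k + 2} \<times> {0..<3}) (int k + 1, 2)"
      by (intro eats_trans) auto
    also have "rect k 3 \<union> {int k..<int k + 2} \<times> {0..<3} = rect n 3"
      by (auto simp: k(3))
    finally show ?thesis by (simp add: k(3) add.commute)
  qed (use walk_5_3_left walk_6_3_left in simp_all)
qed

lemma reaches_extend:
  assumes "reaches k (rect n m) (i, int m - 1)" and "eats (i, -1) (rect n 3) (j, 2)"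
    and "0 \<le> j" "j < int n"
  shows "reaches k (rect n (m + 3)) (j, int m + 2)"
proof -
  have "eats (i, int m - 1) ({0..<int n} \<times> {int m..<int m + 3}) (j, int m + 2)"
    using eats_affine[OF assms(2), of False 0 False "int m"] by (simp add: affine_image)
  then have "reaches k (rect n m \<union> {0..<int n} \<times> {int m..<int m + 3}) (j, int m + 2)"
    by (rule reaches_trans[OF assms(1)]) (use assms(3,4) in auto)
  also have "rect n m \<union> {0..<int n} \<times> {int m..<int m + 3} = rect n (m + 3)"
    by auto
  finally show ?thesis .
qed

lemma corner_add3:
  assumes "corner n m" and "n = 3 \<or> n \<ge> 5"
  shows "corner n (m + 3)"
  using assms(2)
proof
  assume n: "n = 3"
  from reaches_extend[of _ n m, OF assms(1)[unfolded corner_def], of 0] walk_3_3_left n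
  show ?thesis by (simp add: corner_def leftover_add3 add.commute)
next
  assume n: "n \<ge> 5"
  from reaches_extend[OF assms(1)[unfolded corner_def] walk_strip[OF n]] n
  have "reaches (leftover n m) (rect n (m + 3)) (int n - 1, int m + 2)" by simp
  \<comment> \<open>The walk ends in the bottom right corner. Reversing the rows turns it into the
    top right one.\<close>
  from reaches_affine[OF this, of True "int n - 1" False 0]
  show ?thesis by (simp add: corner_def affine_image leftover_add3 add.commute)
qed

text \<open>Each further strip exchanges rows 0 and 1, so both end positions are carried through the
  induction. The residue 2 is excluded because \<open>4 * m\<close> and \<open>m\<close> agree
  modulo 3.\<close>

lemma reaches_four_rows:
  assumes "m \<ge> 3" and "m mod 3 \<noteq> 2" and "i \<in> {0, 1}"
  shows "reaches (leftover 4 m) (rect 4 m) (i, int m - 1)"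
  using assms
proof (induction m arbitrary: i rule: less_induct)
  case (less m)
  have "m \<noteq> 5" using less.prems(2) by auto
  with less.prems(1) consider "m = 3" | "m = 4" | "m \<ge> 6" by linarith
  then show ?case
  proof cases
    case 1
    with less.prems(3) show ?thesis
      using reaches_4_3_0 reaches_4_3_1 by (auto simp: leftover_def)
  next
    case 2
    with less.prems(3) show ?thesis
      using reaches_4_4_0 reaches_4_4_1 by (auto simp: leftover_def)
  next
    case 3
    define k where "k = m - 3"
    have k: "k < m" "k \<ge> 3" "m = k + 3" "k mod 3 \<noteq> 2"
      using 3 less.prems(2) by (auto simp: k_def mod_if)
    have "eats (1 - i, -1) (rect 4 3) (i, 2)"
      using less.prems(3) walk_4_3_left walk_4_3_left1 by auto
    moreover have "1 - i \<in> {0, 1}" using less.prems(3) by auto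
    ultimately have "reaches (leftover 4 k) (rect 4 (k + 3)) (i, int k + 2)"
      using reaches_extend[OF less.IH[OF k(1,2,4)], of "1 - i"] less.prems(3) by auto
    then show ?thesis by (simp add: k(3) leftover_add3 add.commute)
  qed
qed

lemma corner:
  assumes "n \<ge> 3" "m \<ge> 3" and "n * m mod 3 \<noteq> 2"
  shows "corner n m"
  using assms
proof (induction "n + m" arbitrary: n m rule: less_induct)
  case less
  have four: "corner 4 k" if "k \<ge> 3" "4 * k mod 3 \<noteq> 2" for k
  proof -
    have "k mod 3 \<noteq> 2" using that(2) by presburger
    from reaches_four_rows[OF that(1) this] show ?thesis by (simp add: corner_def)
  qed
  \<comment> \<open>Removing three columns keeps the residue of the area. The claim is stated for
    any \<open>k\<close> and \<open>l\<close> with the given sum so that it also serves the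
    transposed board.\<close>
  have step: "corner k l" if "k \<ge> 3" "l \<ge> 6" "k * l mod 3 \<noteq> 2" "k \<noteq> 4" "k + l = n + m" for k l
  proof -
    have "l = (l - 3) + 3" using that by simp
    then have "k * l = k * (l - 3) + 3 * k" by (metis distrib_left mult.commute)
    then have "k * (l - 3) mod 3 \<noteq> 2" using that(3) by simp
    with that have "corner k (l - 3)" by (intro less.hyps) auto
    with that have "corner k (l - 3 + 3)" by (intro corner_add3) auto
    with that show ?thesis by simp
  qed
  consider "n = 4" | "m = 4" | "n \<noteq> 4" "m \<ge> 6" | "m \<noteq> 4" "n \<ge> 6" | "n \<in> {3, 5}" "m \<in> {3, 5}"
    using less.prems by force
  then show ?case
  proof cases
    case 1
    with four less.prems show ?thesis by simp
  next
    case 2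
    with four[of n] less.prems show ?thesis by (auto intro: corner_transpose simp: mult.commute)
  next
    case 3
    with step[of n m] less.prems show ?thesis by simp
  next
    case 4
    with step[of m n] less.prems show ?thesis by (auto intro: corner_transpose simp: mult.commute)
  next
    case 5
    \<comment> \<open>These are the boards without a side 4 from which no three rows or columns can
      be removed with at least three remaining.\<close>
    have "corner 3 3" "corner 3 5" "corner 5 5"
      using reaches_3_3_0 reaches_3_5_0 reaches_5_5_0 by (auto simp: corner_def leftover_def)
    with 5 corner_transpose show ?thesis by auto
  qed
qed

section \<open>Boards whose area is 2 modulo 3\<close>

lemma finish_strip_inner: "finishes (-1, 1) ({0..<4 + 3 * int k} \<times> {0..<4})"
proof (induction k)
  case 0
  then show ?case using finish_4_4_above1 by simp
next
  case (Suc k)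
  \<comment> \<open>The stone leaves the first three rows in column 2 instead of column 1, so the
    rest of the strip is used with its columns reversed.\<close>
  have "finishes (2, 2) ({3..<7 + 3 * int k} \<times> {0..<4})"
    using finishes_affine[OF Suc.IH, of False 3 True 3] by (simp add: affine_image)
  then have "finishes (-1, 1) ({0..<3} \<times> {0..<4} \<union> {3..<7 + 3 * int k} \<times> {0..<4})"
    by (rule finishes_trans[OF walk_3_4_above1]) auto
  also have "{0..<3} \<times> {0..<4} \<union> {3..<7 + 3 * int k} \<times> {0..<4} =
      {0..<4 + 3 * int (Suc k)} \<times> {0..<4 :: int}" by auto
  finally show ?case .
qed

lemma finish_strip: "finishes (0, -1) ({0..<4 + 3 * int k} \<times> {0..<4})"
proof (cases k)
  case 0
  then show ?thesis using finish_4_4_left by simp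
next
  case (Suc l)
  \<comment> \<open>Only the first block is entered from the side. The rest of the strip is entered
    from above, in column 1.\<close>
  have "finishes (2, 1) ({3..<7 + 3 * int l} \<times> {0..<4})"
    using finishes_affine[OF finish_strip_inner[of l], of False 3 False 0] by (simp add: affine_image)
  then have "finishes (0, -1) ({0..<3} \<times> {0..<4} \<union> {3..<7 + 3 * int l} \<times> {0..<4})"
    by (rule finishes_trans[OF walk_3_4_left]) auto
  also have "{0..<3} \<times> {0..<4} \<union> {3..<7 + 3 * int l} \<times> {0..<4} =
      {0..<4 + 3 * int k} \<times> {0..<4 :: int}" by (auto simp: Suc)
  finally show ?thesis .
qed

lemma reducible_if_corner_finishes:
  assumes "corner n m" and "\<not> 3 dvd n * m" and "finishes (0, -1) (rect n k)"
  shows "reducible 1 (board (rect n (m + k)))"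
proof -
  have "finishes (0, int m - 1) ({0..<int n} \<times> {int m..<int m + int k})"
    using finishes_affine[OF assms(3), of False 0 False "int m"] by (simp add: affine_image)
  moreover have "reaches 0 (rect n m) (0, int m - 1)"
    using assms(1,2) by (simp add: corner_def leftover_def)
  ultimately have "reducible 1 (board (rect n m \<union> {0..<int n} \<times> {int m..<int m + int k}))"
    by (intro reducible_if_finishes) auto
  also have "rect n m \<union> {0..<int n} \<times> {int m..<int m + int k} = rect n (m + k)"
    by auto
  finally show ?thesis .
qed

lemma reducible_transpose: "reducible k (board (rect n m)) \<Longrightarrow> reducible k (board (rect m n))"
  using reducible_isometry[OF _ isometry_swap, of k "rect n m"] by (simp add: swap_image)

text \<open>A strip whose area is 1 modulo 3 is split off so that the area of the rest is 1 modulo 3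
  as well and \<open>corner\<close> applies to it. Four columns are split off if \<open>m\<close> is
  at least 8. For \<open>m = 5\<close> only one column would remain, so two rows are split off
  instead.\<close>

lemma reducible_one_two_mod_3:
  assumes "n mod 3 = 1" "m mod 3 = 2" "n \<ge> 4" "m \<ge> 5"
  shows "reducible 1 (board (rect n m))"
proof -
  have "n \<noteq> 5" "n \<noteq> 6" "m \<noteq> 6" "m \<noteq> 7" using assms(1,2) by auto
  with assms(3,4) consider "n = 4" "m = 5" | "n \<ge> 7" "m = 5" | "m \<ge> 8" by linarith
  then show ?thesis
  proof cases
    case 1
    then show ?thesis using reducible_4_5 by simp
  next
    case 2
    then obtain l where l: "n = l + 2" "l \<ge> 5" by (intro that[of "n - 2"]) auto
    have "l mod 3 = 2" using assms(1) unfolding l(1) by presburger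
    then have mod: "5 * l mod 3 = 1" by presburger
    with l have "corner 5 l" by (intro corner) auto
    moreover have "\<not> 3 dvd 5 * l" using mod by presburger
    ultimately have "reducible 1 (board (rect 5 (l + 2)))"
      using finish_5_2_left by (intro reducible_if_corner_finishes) auto
    then show ?thesis unfolding l(1) 2(2) by (rule reducible_transpose)
  next
    case 3
    define k where "k = n div 3 - 1"
    have k: "n = 4 + 3 * k" unfolding k_def using assms(1,3) by presburger
    obtain l where l: "m = l + 4" "l \<ge> 4" using 3 by (intro that[of "m - 4"]) auto
    have l_mod: "l mod 3 = 1" using assms(2) unfolding l(1) by presburger
    have mod: "n * l mod 3 = 1" using mod_mult_eq[of n 3 l] by (simp add: assms(1) l_mod)
    with l assms(3) have "corner n l" by (intro corner) auto
    moreover have "\<not> 3 dvd n * l" using mod by presburger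
    moreover have "finishes (0, -1) (rect n 4)" using finish_strip[of k] by (simp add: k)
    ultimately show ?thesis unfolding l(1) by (rule reducible_if_corner_finishes)
  qed
qed

lemma reducible_rect:
  assumes "n \<ge> 2" "m \<ge> 2"
  shows "reducible (if n * m mod 3 = 0 then 2 else 1) (board (rect n m))"
proof -
  have two: "reducible (if 2 * k mod 3 = 0 then 2 else 1) (board (rect 2 k))" if "k \<ge> 2" for k
  proof -
    have "2 * k mod 3 = 0 \<longleftrightarrow> k mod 3 = 0" by presburger
    with reducible_two_rows[OF that] show ?thesis by simp
  qed
  consider "n = 2" | "m = 2" | "n \<ge> 3" "m \<ge> 3" using assms by linarith
  then show ?thesis
  proof cases
    case 1
    with two assms show ?thesis by simp
  next
    case 2
    with reducible_transpose[OF two[OF assms(1)]] show ?thesis by (simp add: mult.commute)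
  next
    case 3
    show ?thesis
    proof (cases "n * m mod 3 = 2")
      case False
      from reducible_if_reaches[OF corner[OF 3 False, unfolded corner_def]]
      show ?thesis by (auto simp: leftover_def dvd_eq_mod_eq_0 numeral_2_eq_2 split: if_splits)
    next
      case True
      have "n mod 3 \<in> {0, 1, 2}" "m mod 3 \<in> {0, 1, 2}" by auto
      moreover have "(n mod 3) * (m mod 3) mod 3 = 2" using True by (simp add: mod_mult_eq)
      \<comment> \<open>Among products of two residues modulo 3, only 1 times 2 gives 2.\<close>
      ultimately have "n mod 3 = 1 \<and> m mod 3 = 2 \<or> n mod 3 = 2 \<and> m mod 3 = 1"
        by (elim insertE) auto
      then show ?thesis
      proof
        assume *: "n mod 3 = 1 \<and> m mod 3 = 2"
        then have "n \<noteq> 3" "m \<noteq> 3" "m \<noteq> 4" by auto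
        with 3 have "n \<ge> 4" "m \<ge> 5" by linarith+
        with * True reducible_one_two_mod_3 show ?thesis by simp
      next
        assume *: "n mod 3 = 2 \<and> m mod 3 = 1"
        then have "m \<noteq> 3" "n \<noteq> 3" "n \<noteq> 4" by auto
        with 3 have "n \<ge> 5" "m \<ge> 4" by linarith+
        with * True reducible_one_two_mod_3 show ?thesis by (auto intro: reducible_transpose)
      qed
    qed
  qed
qed

theorem theorem4:
  fixes n m :: nat and a b :: int
  assumes "n \<ge> 2" and "m \<ge> 2"
  shows "if (n * m) mod 3 = 0 then reducible 2 (checkerboard a b n m)
         else reducible 1 (checkerboard a b n m)"
proof -
  \<comment> \<open>Translating the board at the origin covers both colourings, since an odd shift
    exchanges the colours.\<close>
  have "checkerboard a b n m = board (affine False a False b ` rect n m)"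
    by (simp add: checkerboard_eq_board affine_image)
  with reducible_isometry[OF reducible_rect[OF assms] isometry_affine, of False a False b]
  show ?thesis by (simp split: if_splits)
qed

end
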